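(* For $n>0$ let $b=b^*(n)$ be the bifurcation curve corresponding to the heteroclinic connection for the quadratic system $$\dot x=y,\qquad \dot y=-x+by+xy-ny^2,$$ with $b>0$, $n>0$. Then: (i) For $n>14$, $$\left|\frac1{4n}-b^*(n)\right|<\frac1{8n^3}.$$ (ii) For $n>5$, $$\left|\frac1{4n}-\frac1{64n^3}-b^*(n)\right|<\frac1{2n^5}.$$ (iii) For $n>26$, $$\left|\frac1{4n}-\frac1{64n^3}-\frac5{512n^5}-b^*(n)\right|<\frac1{8n^7}.$$
   Context: Definition of $b^*$. Consider the planar system $\dot x=y$, $\dot y=-x+by+xy-ny^2$ with real parameters $(n,b)$. It is known that there is a function $b^*(n)$ with $b^*(-n)=-b^*(n)$ and $n\,b^*(n)>0$ for $n\neq 0$, such that the system has exactly one limit cycle, which is hyperbolic, if either $n>0$ and $0<b<b^*(n)$, or $n<0$ and $b^*(n)<b<0$; otherwise it has no limit cycles. For $n>0$ this determines $b^*(n)$. For each $n>0$, the value $b=b^*(n)$ is the one for which, in the Poincaré compactification, the system has a heteroclinic connection between two semi-hyperbolic critical points at infinity, in the directions $y=0$ and $x-ny=0$; the limit cycle, born in an Andronov-Hopf bifurcation, disappears at this value. *)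

theory Defs
  imports "HOL-Analysis.Analysis"
begin

section \<open>Planar autonomous systems\<close>

definition solves :: "(real \<times> real \<Rightarrow> real \<times> real) \<Rightarrow> (real \<Rightarrow> real \<times> real) \<Rightarrow> real set \<Rightarrow> bool" where
  "solves F \<gamma> I \<longleftrightarrow> (\<forall>t\<in>I. (\<gamma> has_vector_derivative F (\<gamma> t)) (at t within I))"

text \<open>\<open>T\<close> is the minimal period, and injectivity on one period excludes equilibria.\<close>

definition periodic_solution :: "(real \<times> real \<Rightarrow> real \<times> real) \<Rightarrow> (real \<Rightarrow> real \<times> real) \<Rightarrow> real \<Rightarrow> bool" where
  "periodic_solution F \<gamma> T \<longleftrightarrow>
     solves F \<gamma> UNIV \<and> T > 0 \<and> (\<forall>t. \<gamma> (t + T) = \<gamma> t) \<and> inj_on \<gamma> {0..<T}"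

definition periodic_orbit :: "(real \<times> real \<Rightarrow> real \<times> real) \<Rightarrow> (real \<times> real) set \<Rightarrow> bool" where
  "periodic_orbit F C \<longleftrightarrow> (\<exists>\<gamma> T. periodic_solution F \<gamma> T \<and> C = range \<gamma>)"

definition limit_cycle :: "(real \<times> real \<Rightarrow> real \<times> real) \<Rightarrow> (real \<times> real) set \<Rightarrow> bool" where
  "limit_cycle F C \<longleftrightarrow>
     periodic_orbit F C \<and>
     (\<exists>U. open U \<and> C \<subseteq> U \<and> (\<forall>C'. periodic_orbit F C' \<and> C' \<subseteq> U \<longrightarrow> C' = C))"

text \<open>
  \<open>\<pi>\<close> is the Poincare return map on the transversal segment \<open>s \<mapsto> \<gamma> 0 + s w\<close> and \<open>\<tau>\<close> is the
  return time. Continuity of \<open>\<tau>\<close> at 0 together with \<open>\<tau> 0 = T\<close> selects the return that follows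
  the cycle once, which determines \<open>\<pi>\<close> near 0. Hyperbolicity means that the derivative of
  the return map at the cycle is different from 1.
\<close>

definition hyperbolic_cycle :: "(real \<times> real \<Rightarrow> real \<times> real) \<Rightarrow> (real \<times> real) set \<Rightarrow> bool" where
  "hyperbolic_cycle F C \<longleftrightarrow>
     (\<exists>\<gamma> T w \<epsilon> \<tau> \<pi> d.
        periodic_solution F \<gamma> T \<and> C = range \<gamma> \<and>
        fst (F (\<gamma> 0)) * snd w - snd (F (\<gamma> 0)) * fst w \<noteq> 0 \<and>
        \<epsilon> > 0 \<and> isCont \<tau> 0 \<and> \<tau> 0 = T \<and>
        (\<forall>s. \<bar>s\<bar> < \<epsilon> \<longrightarrow> \<tau> s > 0 \<and>
           (\<exists>\<phi>. solves F \<phi> {0..\<tau> s} \<and>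
                \<phi> 0 = \<gamma> 0 + s *\<^sub>R w \<and> \<phi> (\<tau> s) = \<gamma> 0 + \<pi> s *\<^sub>R w)) \<and>
        (\<pi> has_real_derivative d) (at 0) \<and> d \<noteq> 1)"

text \<open>
  The Poincare disk model: the plane is mapped onto the open unit disk, and the point at
  infinity in the direction \<open>v\<close> is the point \<open>sgn v = v / norm v\<close> of the boundary circle.
\<close>

definition poincare_disk :: "real \<times> real \<Rightarrow> real \<times> real" where
  "poincare_disk p = (1 / sqrt (1 + (norm p)\<^sup>2)) *\<^sub>R p"

definition connection_at_infinity :: "(real \<times> real \<Rightarrow> real \<times> real) \<Rightarrow> real \<times> real \<Rightarrow> real \<times> real \<Rightarrow> bool" where
  "connection_at_infinity F u v \<longleftrightarrow>
     (\<exists>\<gamma>. solves F \<gamma> UNIV \<and>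
          ((\<lambda>t. poincare_disk (\<gamma> t)) \<longlongrightarrow> sgn u) at_bot \<and>
          ((\<lambda>t. poincare_disk (\<gamma> t)) \<longlongrightarrow> sgn v) at_top)"

section \<open>The quadratic system\<close>

definition quad_system :: "real \<Rightarrow> real \<Rightarrow> real \<times> real \<Rightarrow> real \<times> real" where
  "quad_system n b = (\<lambda>(x, y). (y, - x + b * y + x * y - n * y\<^sup>2))"

definition limit_cycle_threshold :: "real \<Rightarrow> real \<Rightarrow> bool" where
  "limit_cycle_threshold n \<beta> \<longleftrightarrow>
     0 < \<beta> \<and>
     (\<forall>b. if 0 < b \<and> b < \<beta>
          then (\<exists>C. {C'. limit_cycle (quad_system n b) C'} = {C} \<and>
                    hyperbolic_cycle (quad_system n b) C)
          else {C'. limit_cycle (quad_system n b) C'} = {})"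

lemma limit_cycle_threshold_unique:
  assumes "limit_cycle_threshold n \<beta>" "limit_cycle_threshold n \<beta>'"
  shows "\<beta> = \<beta>'"
proof -
  have no_less: False
    if less: "\<alpha> < \<alpha>'" and 1: "limit_cycle_threshold n \<alpha>" and 2: "limit_cycle_threshold n \<alpha>'"
    for \<alpha> \<alpha>'
  proof -
    have "{C'. limit_cycle (quad_system n \<alpha>) C'} = {}"
      using 1 unfolding limit_cycle_threshold_def by (metis less_irrefl)
    moreover have "\<exists>C. {C'. limit_cycle (quad_system n \<alpha>) C'} = {C}"
      using 1 2 less unfolding limit_cycle_threshold_def by metis
    ultimately show False by auto
  qed
  show ?thesis
    using no_less assms by (metis linorder_less_linear)
qed

text \<open>
  For \<open>n > 0\<close> each of the directions \<open>y = 0\<close> and \<open>x - n y = 0\<close> carries two antipodal points at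
  infinity. The connection in which the limit cycle disappears goes around the origin and
  joins the two points with \<open>x < 0\<close>. In the chart \<open>u = y / x\<close>, \<open>z = 1 / x\<close> with time \<open>ds = x dt\<close>
  the system becomes \<open>u' = - z + b u z + u - n u\<^sup>2 - u\<^sup>2 z\<close>, \<open>z' = - u z\<^sup>2\<close>, so
  \<open>u = 0\<close> and \<open>u = 1/n\<close> on \<open>z = 0\<close> are semi-hyperbolic. In the half plane \<open>x < 0\<close> and in the
  original time, exactly one orbit leaves the first of them and exactly one enters the
  second. The connection says that these two separatrices coincide.
\<close>

definition heteroclinic_at_infinity :: "real \<Rightarrow> real \<Rightarrow> bool" where
  "heteroclinic_at_infinity n b \<longleftrightarrow>
     connection_at_infinity (quad_system n b) (- 1, 0) (- n, - 1)"

end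

theory Submission
  imports Defs "HOL-Computational_Algebra.Polynomial"
begin

text \<open>
  Along the connection the acceleration \<open>Q = y'\<close> is compared with an explicit function of \<open>y\<close>.
  In the variable \<open>q = y / (y - 2)\<close>, which maps \<open>y < 1\<close> onto \<open>(-1, 1)\<close>, and for any polynomial
  \<open>T\<close>, the function \<open>g = Q + (1 - y)\<^sup>2 T(q) / ((2 - y) n)\<close> satisfies a linear equation
  \<open>g' = k g + m\<close>, where \<open>m\<close> is a negative multiple of a polynomial in \<open>q\<close>, the residual of \<open>T\<close>.
  Since \<open>k\<close> behaves like \<open>x\<close> at the beginning and like \<open>-x\<close> at the end of the connection, the
  integrating factor makes \<open>g\<close> vanish at both ends, so the residual cannot have a strict sign.
  For large \<open>n\<close> the system is a slow-fast one with \<open>\<epsilon> = 1 / n\<^sup>2\<close> and the connection is a canard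
  through the fold at the origin. Truncating the canard expansion \<open>T = 1 + \<epsilon> T\<^sub>1 + \<epsilon>\<^sup>2 T\<^sub>2 + \<dots>\<close>,
  \<open>n b = 1/4 - \<epsilon>/64 - 5 \<epsilon>\<^sup>2 / 512 + 63 \<epsilon>\<^sup>3 / 8192 + \<dots>\<close>, gives a residual whose sign is that of the
  error in \<open>b\<close> as soon as this error exceeds the claimed bounds. The first bound follows from
  the second.
\<close>

section \<open>Linear equations and integrating factors\<close>

text \<open>The function \<open>f t * exp t\<close> is eventually nonincreasing, so \<open>f\<close>
  lies below a constant times \<open>exp (- t)\<close>.\<close>

lemma exp_decay_at_top:
  fixes f f' :: "real \<Rightarrow> real"
  assumes "eventually (\<lambda>t. (f has_real_derivative f' t) (at t) \<and> f' t \<le> - f t \<and> 0 \<le> f t) at_top"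
  shows "(f \<longlongrightarrow> 0) at_top"
proof -
  obtain t0 where t0: "\<And>t. t \<ge> t0 \<Longrightarrow> (f has_real_derivative f' t) (at t) \<and> f' t \<le> - f t \<and> 0 \<le> f t"
    using assms unfolding eventually_at_top_linorder by blast
  have le: "f t \<le> f t0 * exp t0 * exp (- t)" if "t \<ge> t0" for t
  proof -
    have "f t * exp t \<le> f t0 * exp t0"
    proof (rule DERIV_nonpos_imp_nonincreasing[OF that])
      fix s assume s: "t0 \<le> s" "s \<le> t"
      have "((\<lambda>t. f t * exp t) has_real_derivative (f' s + f s) * exp s) (at s)"
        using t0[OF s(1)] by (auto intro!: derivative_eq_intros simp: algebra_simps)
      moreover have "(f' s + f s) * exp s \<le> 0"
        using t0[OF s(1)] by (intro mult_nonpos_nonneg) auto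
      ultimately show "\<exists>y. ((\<lambda>t. f t * exp t) has_real_derivative y) (at s) \<and> y \<le> 0"
        by blast
    qed
    hence "f t * exp t * exp (- t) \<le> f t0 * exp t0 * exp (- t)"
      by (intro mult_right_mono) auto
    thus ?thesis by (simp add: mult.assoc flip: exp_add)
  qed
  have "((\<lambda>t::real. exp (- t)) \<longlongrightarrow> 0) at_top"
    by (rule filterlim_compose[OF exp_at_bot filterlim_uminus_at_bot_at_top])
  hence lim: "((\<lambda>t. f t0 * exp t0 * exp (- t)) \<longlongrightarrow> 0) at_top"
    by (intro tendsto_mult_right_zero)
  show ?thesis
    by (rule tendsto_sandwich[OF _ _ tendsto_const lim])
       (auto simp: eventually_at_top_linorder intro!: exI[of _ t0] le t0[THEN conjunct2, THEN conjunct2])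
qed

text \<open>The logarithmic derivative is \<open>2 * (y t / x t) - k t\<close>. Its first term
  converges, while \<open>k t = k t / x t * x t\<close> tends to infinity because
  \<open>l < 0\<close> and \<open>x\<close> tends to minus infinity. Hence it is eventually at most
  -1. The factor \<open>(x t)\<^sup>2\<close> leaves room for functions of quadratic growth in
  \<open>x\<close>.\<close>

lemma integrating_factor_decay_at_top:
  fixes x y k P :: "real \<Rightarrow> real"
  assumes x: "\<And>t. (x has_real_derivative y t) (at t)"
    and P: "\<And>t. (P has_real_derivative k t) (at t)"
    and x_lim: "filterlim x at_bot at_top"
    and yx: "((\<lambda>t. y t / x t) \<longlongrightarrow> c) at_top"
    and kx: "((\<lambda>t. k t / x t) \<longlongrightarrow> l) at_top" and "l < 0"
  shows "((\<lambda>t. (x t)\<^sup>2 * exp (- P t)) \<longlongrightarrow> 0) at_top"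
proof (rule exp_decay_at_top)
  let ?f' = "\<lambda>t. (2 * x t * y t - (x t)\<^sup>2 * k t) * exp (- P t)"
  have x_neg: "eventually (\<lambda>t. x t < 0) at_top"
    using x_lim by (simp add: filterlim_at_bot_dense)
  have "filterlim (\<lambda>t. k t / x t * x t) at_top at_top"
    using filterlim_tendsto_neg_mult_at_top_iff[OF kx \<open>l < 0\<close>] x_lim by blast
  hence "filterlim (\<lambda>t. - (2 * (y t / x t)) + k t / x t * x t) at_top at_top"
    by (rule filterlim_tendsto_add_at_top[OF tendsto_minus[OF tendsto_mult_left[OF yx]]])
  hence "eventually (\<lambda>t. - (2 * (y t / x t)) + k t / x t * x t \<ge> 1) at_top"
    by (simp add: filterlim_at_top)
  thus "eventually (\<lambda>t. ((\<lambda>t. (x t)\<^sup>2 * exp (- P t)) has_real_derivative ?f' t) (at t) \<and>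
     ?f' t \<le> - ((x t)\<^sup>2 * exp (- P t)) \<and> 0 \<le> (x t)\<^sup>2 * exp (- P t)) at_top"
    using x_neg
  proof eventually_elim
    case (elim t)
    have deriv: "((\<lambda>t. (x t)\<^sup>2 * exp (- P t)) has_real_derivative ?f' t) (at t)"
      using x[of t] P[of t] by (auto intro!: derivative_eq_intros simp: algebra_simps)
    have "(2 * x t * y t - (x t)\<^sup>2 * k t) = - ((x t)\<^sup>2 * (- (2 * (y t / x t)) + k t / x t * x t))"
      using elim(2) by (simp add: field_simps power2_eq_square)
    moreover have "(x t)\<^sup>2 * 1 \<le> (x t)\<^sup>2 * (- (2 * (y t / x t)) + k t / x t * x t)"
      using elim(1) by (intro mult_left_mono) auto
    ultimately have "(2 * x t * y t - (x t)\<^sup>2 * k t) * exp (- P t) \<le> - (x t)\<^sup>2 * exp (- P t)"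
      by (intro mult_right_mono) auto
    thus ?case
      using deriv by simp
  qed
qed

text \<open>Time reversal reduces this to the other end. It changes the signs of \<open>y\<close>
  and \<open>k\<close>, hence those of \<open>c\<close> and \<open>l\<close>.\<close>

lemma integrating_factor_decay_at_bot:
  fixes x y k P :: "real \<Rightarrow> real"
  assumes x: "\<And>t. (x has_real_derivative y t) (at t)"
    and P: "\<And>t. (P has_real_derivative k t) (at t)"
    and x_lim: "filterlim x at_bot at_bot"
    and yx: "((\<lambda>t. y t / x t) \<longlongrightarrow> c) at_bot"
    and kx: "((\<lambda>t. k t / x t) \<longlongrightarrow> l) at_bot" and "l > 0"
  shows "((\<lambda>t. (x t)\<^sup>2 * exp (- P t)) \<longlongrightarrow> 0) at_bot"
proof -
  have "((\<lambda>t. (x (- t))\<^sup>2 * exp (- P (- t))) \<longlongrightarrow> 0) at_top"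
  proof (rule integrating_factor_decay_at_top)
    show "((\<lambda>t. x (- t)) has_real_derivative - y (- t)) (at t)" for t
      using DERIV_chain2[OF x DERIV_minus[OF DERIV_ident]] by simp
    show "((\<lambda>t. P (- t)) has_real_derivative - k (- t)) (at t)" for t
      using DERIV_chain2[OF P DERIV_minus[OF DERIV_ident]] by simp
    show "filterlim (\<lambda>t. x (- t)) at_bot at_top"
      using x_lim by (simp add: filterlim_at_bot_mirror)
    show "((\<lambda>t. - y (- t) / x (- t)) \<longlongrightarrow> - c) at_top"
      using tendsto_minus[OF yx] by (simp add: filterlim_at_bot_mirror)
    show "((\<lambda>t. - k (- t) / x (- t)) \<longlongrightarrow> - l) at_top"
      using tendsto_minus[OF kx] by (simp add: filterlim_at_bot_mirror)
    show "- l < 0" using \<open>l > 0\<close> by simp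
  qed
  thus ?thesis by (simp add: filterlim_at_bot_mirror)
qed

lemma continuous_antiderivative:
  fixes k :: "real \<Rightarrow> real"
  assumes "\<And>t. isCont k t"
  obtains P where "\<And>t. (P has_real_derivative k t) (at t)"
proof -
  have "\<exists>P. \<forall>t. - \<infinity> < ereal t \<longrightarrow> ereal t < \<infinity> \<longrightarrow> (P has_vector_derivative k t) (at t)"
    by (rule einterval_antiderivative) (use assms in auto)
  thus ?thesis using that by (auto simp: has_real_derivative_iff_has_vector_derivative)
qed

lemma integrating_factor:
  fixes g k m P :: "real \<Rightarrow> real"
  assumes "(g has_real_derivative g t * k t + m t) (at t)" "(P has_real_derivative k t) (at t)"
  shows "((\<lambda>t. g t * exp (- P t)) has_real_derivative m t * exp (- P t)) (at t)"
  using assms by (auto intro!: derivative_eq_intros simp: algebra_simps)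

lemma tendsto_mult_quadratic_zero:
  fixes g x w :: "'a \<Rightarrow> real"
  assumes "((\<lambda>t. (x t)\<^sup>2 * w t) \<longlongrightarrow> 0) F" "((\<lambda>t. g t / (x t)\<^sup>2) \<longlongrightarrow> l) F" "filterlim x at_bot F"
  shows "((\<lambda>t. g t * w t) \<longlongrightarrow> 0) F"
proof -
  have "((\<lambda>t. g t / (x t)\<^sup>2 * ((x t)\<^sup>2 * w t)) \<longlongrightarrow> l * 0) F"
    by (intro tendsto_mult assms)
  moreover have "eventually (\<lambda>t. x t < 0) F"
    using assms(3) by (simp add: filterlim_at_bot_dense)
  hence "eventually (\<lambda>t. g t / (x t)\<^sup>2 * ((x t)\<^sup>2 * w t) = g t * w t) F"
    by eventually_elim simp
  ultimately show ?thesis by (simp add: filterlim_cong)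
qed

lemma DERIV_pos_limits_less:
  fixes h h' :: "real \<Rightarrow> real"
  assumes h: "\<And>t. (h has_real_derivative h' t) (at t)" "\<And>t. h' t > 0"
    and lim: "(h \<longlongrightarrow> a) at_bot" "(h \<longlongrightarrow> b) at_top"
  shows "a < b"
proof -
  have less: "h s < h t" if "s < t" for s t
    using DERIV_pos_imp_increasing[OF that, of h] h by blast
  have "a \<le> h 0"
    by (rule tendsto_upperbound[OF lim(1)])
       (auto intro!: exI[of _ "0::real"] simp: eventually_at_bot_dense less_imp_le less)
  \<comment> \<open>Passing to the limit only gives weak inequalities; the strict one comes from two
    fixed times between the ends.\<close>
  also have "\<dots> < h 1" by (rule less) simp
  also have "\<dots> \<le> b"
    by (rule tendsto_lowerbound[OF lim(2)])
       (auto intro!: exI[of _ "1::real"] simp: eventually_at_top_dense less_imp_le less)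
  finally show ?thesis .
qed

text \<open>The disk model multiplies both coordinates by the same positive factor \<open>d\<close>,
  which cancels in \<open>y / x\<close>. Since \<open>1 - norm\<^sup>2\<close> of the image is
  \<open>d\<^sup>2\<close> and the limit lies on the unit circle, \<open>d\<close> tends to 0. As
  \<open>d * x\<close> has a negative limit, \<open>x\<close> diverges to minus infinity.\<close>

lemma poincare_disk_limitD:
  fixes x y :: "'a \<Rightarrow> real"
  assumes lim: "((\<lambda>t. poincare_disk (x t, y t)) \<longlongrightarrow> sgn (u, v)) F" and "u < 0"
  shows "filterlim x at_bot F" "((\<lambda>t. y t / x t) \<longlongrightarrow> v / u) F"
proof -
  define d where "d t = 1 / sqrt (1 + (norm (x t, y t))\<^sup>2)" for t
  have nz: "(u, v) \<noteq> 0" and npos: "norm (u, v) > 0" using \<open>u < 0\<close> by (auto simp: zero_prod_def)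
  have d_pos: "d t > 0" for t
    by (simp add: d_def add_pos_nonneg)
  have pd: "poincare_disk (x t, y t) = (d t * x t, d t * y t)" for t
    by (simp add: poincare_disk_def d_def)
  have sgn: "sgn (u, v) = (u / norm (u, v), v / norm (u, v))"
    by (simp add: sgn_div_norm divide_inverse_commute)
  have x: "((\<lambda>t. d t * x t) \<longlongrightarrow> u / norm (u, v)) F"
    using tendsto_fst[OF lim] by (simp only: pd sgn fst_conv)
  have y: "((\<lambda>t. d t * y t) \<longlongrightarrow> v / norm (u, v)) F"
    using tendsto_snd[OF lim] by (simp only: pd sgn snd_conv)
  have u_neg: "u / norm (u, v) < 0" using \<open>u < 0\<close> npos by (rule divide_neg_pos)
  have "((\<lambda>t. (d t * y t) / (d t * x t)) \<longlongrightarrow> (v / norm (u, v)) / (u / norm (u, v))) F"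
    by (rule tendsto_divide[OF y x]) (use u_neg in linarith)
  moreover have "(d t * y t) / (d t * x t) = y t / x t" for t
    using d_pos[of t] by simp
  moreover have "(v / norm (u, v)) / (u / norm (u, v)) = v / u"
    using npos by simp
  ultimately show "((\<lambda>t. y t / x t) \<longlongrightarrow> v / u) F"
    by (simp only:)
  have "((\<lambda>t. 1 - (norm (poincare_disk (x t, y t)))\<^sup>2) \<longlongrightarrow> 1 - (norm (sgn (u, v)))\<^sup>2) F"
    by (intro tendsto_intros lim)
  moreover have "1 - (norm (poincare_disk (x t, y t)))\<^sup>2 = (d t)\<^sup>2" for t
  proof -
    have "1 + (norm (x t, y t))\<^sup>2 > 0" by (rule add_pos_nonneg) auto
    thus ?thesis
      unfolding poincare_disk_def d_def norm_scaleR power_mult_distrib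
      by (simp add: power_divide field_simps)
  qed
  moreover have "norm (sgn (u, v)) = 1"
    using nz by (simp only: norm_sgn if_False)
  ultimately have "((\<lambda>t. (d t)\<^sup>2) \<longlongrightarrow> 0) F"
    by (simp only: power_one diff_self)
  hence "((\<lambda>t. sqrt ((d t)\<^sup>2)) \<longlongrightarrow> sqrt 0) F"
    by (rule tendsto_real_sqrt)
  hence "(d \<longlongrightarrow> 0) F"
    using d_pos by (simp add: less_imp_le)
  hence "filterlim (\<lambda>t. inverse (d t)) at_top F"
    by (rule filterlim_inverse_at_top) (use d_pos in auto)
  hence "filterlim (\<lambda>t. d t * x t * inverse (d t)) at_bot F"
    by (rule filterlim_tendsto_neg_mult_at_bot[OF x u_neg])
  moreover have "d t * x t * inverse (d t) = x t" for t
    using d_pos[of t] by (simp add: field_simps)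
  ultimately show "filterlim x at_bot F" by simp
qed

section \<open>The heteroclinic connection\<close>

lemma heteroclinic_trajectory:
  assumes "heteroclinic_at_infinity n b" "n > 0"
  obtains x y :: "real \<Rightarrow> real" where
    "\<And>t. (x has_real_derivative y t) (at t)"
    "\<And>t. (y has_real_derivative - x t + b * y t + x t * y t - n * (y t)\<^sup>2) (at t)"
    "filterlim x at_bot at_bot" "((\<lambda>t. y t / x t) \<longlongrightarrow> 0) at_bot"
    "filterlim x at_bot at_top" "((\<lambda>t. y t / x t) \<longlongrightarrow> 1 / n) at_top"
proof -
  obtain \<gamma> where \<gamma>: "solves (quad_system n b) \<gamma> UNIV"
    and lim: "((\<lambda>t. poincare_disk (\<gamma> t)) \<longlongrightarrow> sgn (- 1, 0)) at_bot"
      "((\<lambda>t. poincare_disk (\<gamma> t)) \<longlongrightarrow> sgn (- n, - 1)) at_top"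
    using assms(1) unfolding heteroclinic_at_infinity_def connection_at_infinity_def by blast
  define x y where "x t = fst (\<gamma> t)" and "y t = snd (\<gamma> t)" for t
  have pair: "(x t, y t) = \<gamma> t" for t by (simp add: x_def y_def)
  have deriv: "(\<gamma> has_vector_derivative quad_system n b (x t, y t)) (at t)" for t
    using \<gamma> by (simp add: solves_def pair)
  have "(x has_real_derivative y t) (at t)" for t
    using bounded_linear.has_vector_derivative[OF bounded_linear_fst deriv[of t]]
    by (simp add: x_def [abs_def] quad_system_def has_real_derivative_iff_has_vector_derivative)
  moreover have "(y has_real_derivative - x t + b * y t + x t * y t - n * (y t)\<^sup>2) (at t)" for t
    using bounded_linear.has_vector_derivative[OF bounded_linear_snd deriv[of t]]
    by (simp add: y_def [abs_def] quad_system_def has_real_derivative_iff_has_vector_derivative)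
  moreover have "filterlim x at_bot at_bot" "((\<lambda>t. y t / x t) \<longlongrightarrow> 0) at_bot"
    using poincare_disk_limitD[of x y "- 1" 0 at_bot] lim(1) by (simp_all add: pair)
  moreover have "filterlim x at_bot at_top" "((\<lambda>t. y t / x t) \<longlongrightarrow> 1 / n) at_top"
    using poincare_disk_limitD[of x y "- n" "- 1" at_top] lim(2) \<open>n > 0\<close> by (simp_all add: pair)
  ultimately show ?thesis
    by (rule that)
qed

text \<open>For \<open>x\<close> nonzero each expression is a polynomial in \<open>1 / x\<close> and
  \<open>y / x\<close>, which tend to 0 and \<open>c\<close>.\<close>

lemma far_field_limits:
  fixes x y :: "real \<Rightarrow> real"
  assumes x: "filterlim x at_bot F" and yx: "((\<lambda>t. y t / x t) \<longlongrightarrow> c) F"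
  shows "((\<lambda>t. inverse (x t)) \<longlongrightarrow> 0) F"
    and "\<And>p q r. ((\<lambda>t. (p * x t + q + r * y t) / x t) \<longlongrightarrow> p + r * c) F"
    and "((\<lambda>t. (1 - y t) / (x t)\<^sup>2) \<longlongrightarrow> 0) F"
    and "\<And>n b. ((\<lambda>t. (- x t + b * y t + x t * y t - n * (y t)\<^sup>2) / (x t)\<^sup>2) \<longlongrightarrow> c - n * c\<^sup>2) F"
proof -
  show inv: "((\<lambda>t. inverse (x t)) \<longlongrightarrow> 0) F"
    using filterlim_compose[OF tendsto_inverse_0 filterlim_mono[OF x at_bot_le_at_infinity order_refl]] .
  have neg: "eventually (\<lambda>t. x t < 0) F"
    using x by (simp add: filterlim_at_bot_dense)
  show "((\<lambda>t. (p * x t + q + r * y t) / x t) \<longlongrightarrow> p + r * c) F" for p q r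
  proof -
    have "((\<lambda>t. p + q * inverse (x t) + r * (y t / x t)) \<longlongrightarrow> p + q * 0 + r * c) F"
      by (intro tendsto_intros inv yx)
    moreover have "eventually (\<lambda>t. p + q * inverse (x t) + r * (y t / x t) = (p * x t + q + r * y t) / x t) F"
      using neg by eventually_elim (simp add: field_simps)
    ultimately show ?thesis by (simp add: filterlim_cong)
  qed
  show "((\<lambda>t. (1 - y t) / (x t)\<^sup>2) \<longlongrightarrow> 0) F"
  proof -
    have "((\<lambda>t. (inverse (x t))\<^sup>2 - y t / x t * inverse (x t)) \<longlongrightarrow> 0\<^sup>2 - c * 0) F"
      by (intro tendsto_intros inv yx)
    moreover have "eventually (\<lambda>t. (inverse (x t))\<^sup>2 - y t / x t * inverse (x t) = (1 - y t) / (x t)\<^sup>2) F"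
      using neg by eventually_elim (simp add: field_simps power2_eq_square)
    ultimately show ?thesis by (simp add: filterlim_cong)
  qed
  show "((\<lambda>t. (- x t + b * y t + x t * y t - n * (y t)\<^sup>2) / (x t)\<^sup>2) \<longlongrightarrow> c - n * c\<^sup>2) F" for n b
  proof -
    have "((\<lambda>t. - inverse (x t) + b * (y t / x t) * inverse (x t) + y t / x t - n * (y t / x t)\<^sup>2)
        \<longlongrightarrow> - 0 + b * c * 0 + c - n * c\<^sup>2) F"
      by (intro tendsto_intros inv yx)
    moreover have "eventually (\<lambda>t. - inverse (x t) + b * (y t / x t) * inverse (x t) + y t / x t - n * (y t / x t)\<^sup>2
        = (- x t + b * y t + x t * y t - n * (y t)\<^sup>2) / (x t)\<^sup>2) F"
      using neg by eventually_elim (simp add: field_simps power2_eq_square)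
    ultimately show ?thesis by (simp add: filterlim_cong)
  qed
qed

text \<open>
  The line \<open>y = 1\<close> is a transversal (or an invariant line, if \<open>b = n\<close>), since
  \<open>1 - y\<close> satisfies a linear differential equation with constant forcing \<open>n - b\<close>.
\<close>

lemma trajectory_below_one:
  fixes x y :: "real \<Rightarrow> real"
  assumes "n > 0"
    and x: "\<And>t. (x has_real_derivative y t) (at t)"
    and y: "\<And>t. (y has_real_derivative - x t + b * y t + x t * y t - n * (y t)\<^sup>2) (at t)"
    and bot: "filterlim x at_bot at_bot" "((\<lambda>t. y t / x t) \<longlongrightarrow> 0) at_bot"
    and top: "filterlim x at_bot at_top" "((\<lambda>t. y t / x t) \<longlongrightarrow> 1 / n) at_top"
  shows "y t < 1"
proof -
  \<comment> \<open>With this \<open>k\<close> the function \<open>1 - y\<close> satisfies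
    \<open>(1 - y)' = (1 - y) * k + (n - b)\<close>.\<close>
  define k where "k t = x t + b - n - n * y t" for t
  have "isCont k t" for t
    unfolding k_def using DERIV_isCont[OF x] DERIV_isCont[OF y] by (intro continuous_intros) auto
  then obtain P where P: "\<And>t. (P has_real_derivative k t) (at t)"
    by (rule continuous_antiderivative) blast
  define h where "h t = (1 - y t) * exp (- P t)" for t
  have h: "(h has_real_derivative (n - b) * exp (- P t)) (at t)" for t
    unfolding h_def
    by (rule integrating_factor[OF _ P])
       (use y[of t] in \<open>auto intro!: derivative_eq_intros simp: k_def algebra_simps power2_eq_square\<close>)
  have "h t > 0"
  proof (cases "b < n")
    \<comment> \<open>The forcing is positive, so \<open>h\<close> increases from its limit 0 in the
      past.\<close>
    case True
    have less: "h s < h t" if "s < t" for s t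
      by (rule DERIV_pos_imp_increasing[OF that]) (use h True in \<open>force simp: mult_pos_pos\<close>)
    note ends = far_field_limits[OF bot]
    have "((\<lambda>t. k t / x t) \<longlongrightarrow> 1) at_bot"
      unfolding k_def using ends(2)[of "1" "b - n" "- n"] by (simp add: algebra_simps)
    from this zero_less_one have decay: "((\<lambda>t. (x t)\<^sup>2 * exp (- P t)) \<longlongrightarrow> 0) at_bot"
      by (rule integrating_factor_decay_at_bot[OF x P bot])
    have lim: "(h \<longlongrightarrow> 0) at_bot"
      using tendsto_mult_quadratic_zero[OF decay ends(3) bot(1)] by (simp add: h_def [abs_def])
    have "0 \<le> h (t - 1)"
      by (rule tendsto_upperbound[OF lim])
         (auto intro!: exI[of _ "t - 1"] simp: eventually_at_bot_dense less_imp_le less)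
    also have "\<dots> < h t" by (rule less) simp
    finally show ?thesis .
  next
    \<comment> \<open>Now \<open>h\<close> is nonincreasing, so it suffices that it is positive at
      some later time. This holds because \<open>y\<close> becomes negative near the end of the
      connection.\<close>
    case False
    have "filterlim (\<lambda>t. y t / x t * x t) at_bot at_top"
      by (rule filterlim_tendsto_pos_mult_at_bot[OF top(2) _ top(1)]) (use \<open>n > 0\<close> in simp)
    hence "eventually (\<lambda>t. y t / x t * x t < 0) at_top"
      by (simp add: filterlim_at_bot_dense)
    then obtain t0 where t0: "\<And>s. s > t0 \<Longrightarrow> y s / x s * x s < 0"
      unfolding eventually_at_top_dense by blast
    define s where "s = max (t0 + 1) t"
    have "s > t0" by (simp add: s_def)
    from t0[OF this] have "y s < 0" by (cases "x s = 0") auto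
    hence "h s > 0" by (simp add: h_def)
    also have "h s \<le> h t"
      by (rule DERIV_nonpos_imp_nonincreasing)
         (use h False in \<open>force simp: s_def mult_nonpos_nonneg\<close>)+
    finally show ?thesis .
  qed
  thus ?thesis by (simp add: h_def zero_less_mult_iff)
qed

section \<open>The barrier and its residual\<close>

text \<open>Here \<open>e\<close> stands for \<open>1 / n\<^sup>2\<close> and
  \<open>\<kappa>\<close> for \<open>n * b\<close>. Identical vanishing in \<open>q\<close> would
  make the curve \<open>g = 0\<close> of the overview invariant. At \<open>e = 0\<close> the
  constant \<open>T = 1\<close> is a solution; the factor \<open>q\<close> vanishes at the fold
  \<open>y = 0\<close>.\<close>

definition barrier_residual :: "real \<Rightarrow> real \<Rightarrow> real poly \<Rightarrow> real \<Rightarrow> real" where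
  "barrier_residual e \<kappa> T q = q * (poly T q - 1) + e * ((1 - q) / 2)\<^sup>2 * poly T q *
     (\<kappa> - ((1 + q) / 2)\<^sup>2 * poly T q - 2 * ((1 + q) / 2) ^ 3 * poly (pderiv T) q)"

lemma poly_bounded_unit_interval:
  fixes T :: "real poly"
  obtains B where "\<And>q. \<bar>q\<bar> \<le> 1 \<Longrightarrow> \<bar>poly T q\<bar> \<le> B"
proof -
  have "compact (poly T ` {- 1..1})"
    by (intro compact_continuous_image continuous_intros) simp
  then obtain B where "\<forall>q\<in>{- 1..1}. \<bar>poly T q\<bar> \<le> B"
    using compact_imp_bounded bounded_iff by (metis (no_types, lifting) image_eqI real_norm_def)
  thus ?thesis by (intro that[of B]) (simp add: abs_le_iff)
qed

lemma tendsto_mult_bounded_zero: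
  fixes f h :: "'a \<Rightarrow> real"
  assumes "(f \<longlongrightarrow> 0) F" "\<And>t. \<bar>h t\<bar> \<le> B"
  shows "((\<lambda>t. f t * h t) \<longlongrightarrow> 0) F"
  by (rule tendsto_0_le[OF assms(1), of _ B])
     (use assms(2) in \<open>auto simp: abs_mult intro!: always_eventually mult_left_mono\<close>)

text \<open>The multiplier \<open>c\<close> carries the sign of the residual, so upper and lower
  barriers are treated at once.\<close>

lemma barrier_excludes_connection:
  fixes T :: "real poly"
  assumes "n > 0" and conn: "heteroclinic_at_infinity n b"
    and sign: "\<And>q. - 1 < q \<Longrightarrow> q < 1 \<Longrightarrow> c * barrier_residual (1 / n\<^sup>2) (n * b) T q > 0"
  shows False
proof -
  obtain x y where x: "\<And>t. (x has_real_derivative y t) (at t)"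
    and y: "\<And>t. (y has_real_derivative - x t + b * y t + x t * y t - n * (y t)\<^sup>2) (at t)"
    and bot: "filterlim x at_bot at_bot" "((\<lambda>t. y t / x t) \<longlongrightarrow> 0) at_bot"
    and top: "filterlim x at_bot at_top" "((\<lambda>t. y t / x t) \<longlongrightarrow> 1 / n) at_top"
    by (rule heteroclinic_trajectory[OF conn \<open>n > 0\<close>]) (rule that)
  have y_less: "y t < 1" for t
    by (rule trajectory_below_one[OF \<open>n > 0\<close> x y bot top])
  \<comment> \<open>\<open>A\<close> and \<open>R\<close> are polynomials in \<open>q\<close>, hence
    bounded along the trajectory. Their contributions therefore do not affect the limits of
    \<open>k / x\<close> and \<open>g / x\<^sup>2\<close> at the two ends.\<close>
  define Q q A R where "Q t = - x t + b * y t + x t * y t - n * (y t)\<^sup>2"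
    and "q t = y t / (y t - 2)"
    and "A = [:1 / 2, 1 / 2:] * T"
    and "R = [:1 / 4, 0, - 1 / 4:] * (T + [:1, 1:] * pderiv T)" for t
  define g where "g t = Q t + (1 - y t) / n * poly A (q t)" for t
  define k where "k t = x t + b - 2 * n * y t - poly R (q t) / n" for t
  define m where "m t = - (1 - y t) * (2 - y t) * barrier_residual (1 / n\<^sup>2) (n * b) T (q t)" for t
  have q_abs: "- 1 < q t" "q t < 1" for t
    using y_less[of t] by (simp_all add: q_def field_simps)
  have q': "(q has_real_derivative - 2 / (2 - y t)\<^sup>2 * Q t) (at t)" for t
  proof -
    have "(q has_real_derivative (Q t * (y t - 2) - y t * Q t) / ((y t - 2) * (y t - 2))) (at t)"
      unfolding q_def using y[of t] y_less[of t]
      by (intro DERIV_divide) (auto intro!: derivative_eq_intros simp: Q_def)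
    moreover have "Q t * (y t - 2) - y t * Q t = - 2 * Q t" "(y t - 2) * (y t - 2) = (2 - y t)\<^sup>2"
      by (simp_all add: power2_eq_square algebra_simps)
    ultimately show ?thesis by simp
  qed
  have Q': "(Q has_real_derivative - y t + b * Q t + (y t * y t + x t * Q t) - 2 * n * y t * Q t) (at t)" for t
    unfolding Q_def using x[of t] y[of t]
    by (auto intro!: derivative_eq_intros simp: algebra_simps power2_eq_square)
  have g': "(g has_real_derivative g t * k t + m t) (at t)" for t
  proof -
    \<comment> \<open>Naming the reciprocals \<open>w\<close> of \<open>2 - y\<close> and
      \<open>N\<close> of \<open>n\<close> turns the differential identity for \<open>g\<close> into
      a polynomial one, a consequence of \<open>w * (2 - y) = 1\<close>, \<open>N * n = 1\<close>
      and the definition of \<open>Q\<close>.\<close>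
    define w where "w = inverse (2 - y t)"
    have w: "w * (2 - y t) = 1"
      using y_less[of t] by (simp add: w_def)
    have q_w: "q t = 1 - 2 * w"
      using y_less[of t] by (simp add: w_def q_def field_simps)
    define T0 T1 where "T0 = poly T (q t)" and "T1 = poly (pderiv T) (q t)"
    define N where "N = inverse n"
    have N: "N * n = 1"
      using \<open>n > 0\<close> by (simp add: N_def)
    have A: "poly A (q t) = (1 - w) * T0"
      by (simp add: A_def T0_def q_w field_simps)
    have A': "poly (pderiv A) (q t) = T0 / 2 + (1 - w) * T1"
      by (simp add: A_def T0_def T1_def q_w pderiv_add pderiv_smult pderiv_pCons field_simps)
    have R_factors: "poly [:1 / 4, 0, - 1 / 4:] (q t) = w * (1 - w)" "poly [:1, 1:] (q t) = 2 * (1 - w)"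
      by (simp_all add: q_w field_simps)
    have R: "poly R (q t) = w * (1 - w) * (T0 + 2 * (1 - w) * T1)"
      unfolding R_def poly_mult poly_add R_factors T0_def T1_def ..
    have half: "(1 - q t) / 2 = w" "(1 + q t) / 2 = 1 - w"
      by (simp_all add: q_w)
    have w2: "- 2 / (2 - y t)\<^sup>2 * Q t = - 2 * w\<^sup>2 * Q t"
      by (simp add: w_def power_inverse divide_inverse)
    have "((\<lambda>t. poly A (q t)) has_real_derivative poly (pderiv A) (q t) * (- 2 / (2 - y t)\<^sup>2 * Q t)) (at t)"
      by (rule DERIV_chain2[OF poly_DERIV q'])
    hence dA: "((\<lambda>t. poly A (q t)) has_real_derivative (T0 / 2 + (1 - w) * T1) * (- 2 * w\<^sup>2 * Q t)) (at t)"
      unfolding A' w2 .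
    have dN: "((\<lambda>t. (1 - y t) / n) has_real_derivative - Q t * N) (at t)"
      using y[of t] \<open>n > 0\<close> by (auto intro!: derivative_eq_intros simp: Q_def N_def divide_inverse)
    have yN: "(1 - y t) / n = (1 - y t) * N"
      by (simp add: N_def divide_inverse)
    have "(g has_real_derivative (- y t + b * Q t + (y t * y t + x t * Q t) - 2 * n * y t * Q t)
      + ((1 - y t) * N * ((T0 / 2 + (1 - w) * T1) * (- 2 * w\<^sup>2 * Q t)) + - Q t * N * ((1 - w) * T0))) (at t)"
      using DERIV_add[OF Q' DERIV_mult'[OF dN dA]] unfolding A yN g_def .
    moreover have "(- y t + b * Q t + (y t * y t + x t * Q t) - 2 * n * y t * Q t)
      + ((1 - y t) * N * ((T0 / 2 + (1 - w) * T1) * (- 2 * w\<^sup>2 * Q t)) + - Q t * N * ((1 - w) * T0))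
      = (Q t + (1 - y t) * N * ((1 - w) * T0)) * (x t + b - 2 * n * y t - N * (w * (1 - w) * (T0 + 2 * (1 - w) * T1)))
      + (- (1 - y t) * (2 - y t) * ((1 - 2 * w) * (T0 - 1) + N\<^sup>2 * w\<^sup>2 * T0 * (n * b - (1 - w)\<^sup>2 * T0 - 2 * (1 - w) ^ 3 * T1)))"
      using w N Q_def[of t] by algebra
    moreover have "Q t + (1 - y t) * N * ((1 - w) * T0) = g t"
      by (simp add: g_def A N_def divide_inverse)
    moreover have "N * (w * (1 - w) * (T0 + 2 * (1 - w) * T1)) = poly R (q t) / n"
      by (simp only: R N_def divide_inverse mult.commute)
    moreover have "- (1 - y t) * (2 - y t) * ((1 - 2 * w) * (T0 - 1) + N\<^sup>2 * w\<^sup>2 * T0 *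
        (n * b - (1 - w)\<^sup>2 * T0 - 2 * (1 - w) ^ 3 * T1)) = m t"
      unfolding m_def barrier_residual_def T0_def[symmetric] T1_def[symmetric] half
      by (simp add: q_w N_def power_inverse divide_inverse)
    ultimately show ?thesis by (simp add: k_def)
  qed
  have "isCont k t" for t
    unfolding k_def using DERIV_isCont[OF x] DERIV_isCont[OF y] DERIV_isCont[OF q'] \<open>n > 0\<close>
    by (intro continuous_intros) auto
  then obtain P where P: "\<And>t. (P has_real_derivative k t) (at t)"
    by (rule continuous_antiderivative) blast
  obtain BA where BA: "\<And>q. \<bar>q\<bar> \<le> 1 \<Longrightarrow> \<bar>poly A q\<bar> \<le> BA"
    by (rule poly_bounded_unit_interval) blast
  obtain BR where BR: "\<And>q. \<bar>q\<bar> \<le> 1 \<Longrightarrow> \<bar>poly R q\<bar> \<le> BR"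
    by (rule poly_bounded_unit_interval) blast
  have q_le: "\<bar>q t\<bar> \<le> 1" for t
    using q_abs[of t] by linarith
  \<comment> \<open>The slope \<open>d\<close> will be 0 in the past and \<open>1 / n\<close> in the
    future. The limit of \<open>k / x\<close> is then 1 and -1 respectively, the signs that the two
    decay lemmas require.\<close>
  have k_lim: "((\<lambda>t. k t / x t) \<longlongrightarrow> 1 - 2 * n * d) F"
    and g_lim: "((\<lambda>t. g t / (x t)\<^sup>2) \<longlongrightarrow> d - n * d\<^sup>2) F"
    if "filterlim x at_bot F" "((\<lambda>t. y t / x t) \<longlongrightarrow> d) F" for F d
  proof -
    note ends = far_field_limits[OF that]
    have "((\<lambda>t. inverse (x t) * poly R (q t) / n) \<longlongrightarrow> 0) F"
      by (intro tendsto_divide_zero tendsto_mult_bounded_zero[OF ends(1) BR] q_le)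
    from tendsto_diff[OF ends(2)[of 1 b "- 2 * n"] this]
    show "((\<lambda>t. k t / x t) \<longlongrightarrow> 1 - 2 * n * d) F"
      by (simp add: k_def divide_inverse algebra_simps)
    have "((\<lambda>t. (1 - y t) / (x t)\<^sup>2 * poly A (q t) / n) \<longlongrightarrow> 0) F"
      by (intro tendsto_divide_zero tendsto_mult_bounded_zero[OF ends(3) BA] q_le)
    from tendsto_add[OF ends(4)[of b n] this]
    show "((\<lambda>t. g t / (x t)\<^sup>2) \<longlongrightarrow> d - n * d\<^sup>2) F"
      by (simp add: g_def Q_def add_divide_distrib mult_ac)
  qed
  \<comment> \<open>Since \<open>m\<close> is a negative multiple of the residual, the factor
    \<open>- c\<close> makes \<open>h\<close> strictly increasing, although it tends to 0 at both
    ends.\<close>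
  define h where "h t = - c * (g t * exp (- P t))" for t
  have h': "(h has_real_derivative - c * (m t * exp (- P t))) (at t)" for t
    unfolding h_def by (rule DERIV_cmult[OF integrating_factor[OF g' P]])
  have pos: "- c * (m t * exp (- P t)) > 0" for t
  proof -
    have "(1 - y t) * (2 - y t) * exp (- P t) * (c * barrier_residual (1 / n\<^sup>2) (n * b) T (q t)) > 0"
      using y_less[of t] by (intro mult_pos_pos[OF _ sign[OF q_abs[of t]]] mult_pos_pos) auto
    also have "(1 - y t) * (2 - y t) * exp (- P t) * (c * barrier_residual (1 / n\<^sup>2) (n * b) T (q t))
        = - c * (m t * exp (- P t))"
      unfolding m_def by algebra
    finally show ?thesis .
  qed
  have "((\<lambda>t. g t * exp (- P t)) \<longlongrightarrow> 0) at_bot"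
    by (rule tendsto_mult_quadratic_zero[OF integrating_factor_decay_at_bot[OF x P bot k_lim[OF bot]] g_lim[OF bot] bot(1)]) simp
  hence "(h \<longlongrightarrow> 0) at_bot"
    unfolding h_def by (rule tendsto_mult_right_zero)
  moreover have "((\<lambda>t. g t * exp (- P t)) \<longlongrightarrow> 0) at_top"
    by (rule tendsto_mult_quadratic_zero[OF integrating_factor_decay_at_top[OF x P top k_lim[OF top]] g_lim[OF top] top(1)])
       (use \<open>n > 0\<close> in simp)
  hence "(h \<longlongrightarrow> 0) at_top"
    unfolding h_def by (rule tendsto_mult_right_zero)
  ultimately show False
    using DERIV_pos_limits_less[OF h' pos] by blast
qed

section \<open>The canard expansion\<close>

text \<open>
  \<open>profile\<close>\<open>k\<close> is the coefficient \<open>T\<^sub>k\<close> of the canard expansion, and \<open>defect\<close>\<open>k\<close> is the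
  coefficient of \<open>\<epsilon>\<^sup>k\<close> in \<open>n b - r\<^sup>2 T - 2 r\<^sup>3 T'\<close> for \<open>r = (1 + q) / 2\<close>. The value of \<open>n b\<close> at
  order \<open>k\<close> is the one for which the equation determining \<open>T\<^sub>k\<^sub>+\<^sub>1\<close> can be divided by \<open>q\<close>.
\<close>

definition defect0 :: "real poly" where
  "defect0 = [:0, - 1 / 2, - 1 / 4:]"

definition profile1 :: "real poly" where
  "profile1 = [:1 / 8, - 3 / 16, 0, 1 / 16:]"

definition defect1 :: "real poly" where
  "defect1 = [:0, 1 / 8, 5 / 32, - 1 / 16, - 11 / 64, - 1 / 16:]"

definition profile2 :: "real poly" where
  "profile2 = [:- 1 / 64, - 3 / 128, 25 / 256, - 3 / 256, - 5 / 64, 3 / 256, 5 / 256:]"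

definition defect2 :: "real poly" where
  "defect2 = [:0, - 9 / 512, - 33 / 256, - 39 / 512, 203 / 1024, 107 / 512, - 23 / 512, - 59 / 512, - 35 / 1024:]"

definition profile3 :: "real poly" where
  "profile3 = [:- 3 / 2048, 33 / 1024, - 43 / 2048, - 191 / 2048, 29 / 512, 213 / 2048, - 99 / 2048, - 27 / 512, 27 / 2048, 11 / 1024:]"

definition defect3 :: "real poly" where
  "defect3 = [:0, - 43 / 2048, 547 / 8192, 829 / 4096, - 343 / 8192, - 1837 / 4096, - 391 / 2048, 1431 / 4096, 9 / 32, - 227 / 4096, - 881 / 8192, - 55 / 2048:]"

section \<open>Bounds for the expansion polynomials on the unit interval\<close>

lemma abs_add_mult_le:
  fixes a b q :: real
  assumes "\<bar>a\<bar> \<le> A" "\<bar>b\<bar> \<le> B" "\<bar>q\<bar> \<le> 1"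
  shows "\<bar>a + q * b\<bar> \<le> A + B"
proof -
  have "\<bar>q * b\<bar> \<le> 1 * B"
    unfolding abs_mult using assms by (intro mult_mono) auto
  thus ?thesis using assms(1) by linarith
qed

lemma abs_poly_le_sum_list:
  fixes cs :: "real list"
  assumes "\<bar>x\<bar> \<le> 1"
  shows "\<bar>poly (Poly cs) x\<bar> \<le> (\<Sum>c\<leftarrow>cs. \<bar>c\<bar>)"
  using assms by (induction cs) (auto intro!: abs_add_mult_le)

text \<open>The constants are the sums of the absolute values of the coefficients, rounded
  up.\<close>

lemma profile_bounds:
  assumes "\<bar>q\<bar> \<le> 1"
  shows "\<bar>poly profile1 q\<bar> \<le> 3 / 8" "\<bar>poly defect1 q\<bar> \<le> 3 / 5"
    "\<bar>poly profile2 q\<bar> \<le> 3 / 10" "\<bar>poly defect2 q\<bar> \<le> 5 / 6"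
    "\<bar>poly profile3 q\<bar> \<le> 1 / 2" "\<bar>poly defect3 q\<bar> \<le> 2"
  using abs_poly_le_sum_list[OF assms, of "coeffs profile1"] abs_poly_le_sum_list[OF assms, of "coeffs profile2"]
    abs_poly_le_sum_list[OF assms, of "coeffs profile3"] abs_poly_le_sum_list[OF assms, of "coeffs defect1"]
    abs_poly_le_sum_list[OF assms, of "coeffs defect2"] abs_poly_le_sum_list[OF assms, of "coeffs defect3"]
  by (simp_all add: profile1_def defect1_def profile2_def defect2_def profile3_def defect3_def del: poly_pCons)

text \<open>
  In powers of \<open>q\<^sup>2\<close> the coefficients are too large for the triangle inequality to be useful,
  so the even and odd parts are expanded around the midpoint \<open>q\<^sup>2 = 1/2\<close>.
\<close>

lemma abs_poly_even_odd_le: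
  fixes p :: "real poly"
  assumes p: "p = Poly es \<circ>\<^sub>p [:- 1, 0, 2:] + [:0, 1:] * (Poly os \<circ>\<^sub>p [:- 1, 0, 2:])"
    and q: "\<bar>q\<bar> \<le> 1"
  shows "\<bar>poly p q\<bar> \<le> (\<Sum>c\<leftarrow>es. \<bar>c\<bar>) + (\<Sum>c\<leftarrow>os. \<bar>c\<bar>)"
proof -
  \<comment> \<open>The variable \<open>2 * q\<^sup>2 - 1\<close> is centred at
    \<open>q\<^sup>2 = 1/2\<close> and stays in the unit interval, so the coefficient sum bounds
    both parts.\<close>
  have "\<bar>poly [:- 1, 0, 2:] q\<bar> \<le> 1"
    using q abs_square_le_1[of q] by (simp add: abs_le_iff power2_eq_square)
  hence "\<bar>poly (Poly es) (poly [:- 1, 0, 2:] q) + q * poly (Poly os) (poly [:- 1, 0, 2:] q)\<bar>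
      \<le> (\<Sum>c\<leftarrow>es. \<bar>c\<bar>) + (\<Sum>c\<leftarrow>os. \<bar>c\<bar>)"
    by (intro abs_add_mult_le q abs_poly_le_sum_list)
  thus ?thesis
    by (simp only: p poly_add poly_mult poly_pcompose) simp
qed

text \<open>This polynomial is the leading part of the second-order residual apart from the error in
  \<open>b\<close>. The lists hold the coefficients of its even and odd parts in powers of
  \<open>2 * q\<^sup>2 - 1\<close>.\<close>

lemma second_order_defect_bound:
  assumes "\<bar>q\<bar> \<le> 1"
  shows "\<bar>poly (defect2 + profile1 * defect1 + profile2 * defect0) q\<bar> \<le> 1 / 5"
  by (rule order_trans[OF abs_poly_even_odd_le[OF _ assms, of _
        "[- 81 / 4096, 11 / 1024, 5 / 256, - 7 / 512, - 11 / 4096]"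
        "[- 75 / 4096, 51 / 4096, 79 / 4096, - 71 / 4096]"]])
     (simp_all add: defect2_def profile1_def defect1_def profile2_def defect0_def pcompose_pCons)

text \<open>The analogue one order higher. The margin is small here: the coefficient sum is about
  0.107.\<close>

lemma third_order_defect_bound:
  assumes "\<bar>q\<bar> \<le> 1"
  shows "\<bar>poly (defect3 + profile1 * defect2 + profile2 * defect1 + profile3 * defect0) q\<bar> \<le> 11 / 100"
  by (rule order_trans[OF abs_poly_even_odd_le[OF _ assms, of _
        "[5415 / 524288, - 1777 / 524288, - 2723 / 262144, 2701 / 262144, 1567 / 524288, - 2089 / 524288]"
        "[5185 / 524288, - 5007 / 524288, - 3491 / 262144, 6213 / 262144, - 4123 / 524288, - 539 / 524288]"]])
     (simp_all add: defect3_def profile1_def defect2_def profile2_def defect1_def profile3_def defect0_def pcompose_pCons)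

section \<open>Residuals of the truncated expansions\<close>

text \<open>These are the equations that determine the profiles order by order. The quadratic factor
  is \<open>((1 - q) / 2)\<^sup>2\<close>, and its cofactor is the coefficient of the preceding
  power of \<open>e\<close> in the product of the profile and defect series.\<close>

lemma residual_factor_q:
  "[:0, 1:] * profile1 = - ([:1 / 4, - 1 / 2, 1 / 4:] * defect0)"
  "[:0, 1:] * profile2 = - ([:1 / 4, - 1 / 2, 1 / 4:] * (defect1 + profile1 * defect0))"
  "[:0, 1:] * profile3 = - ([:1 / 4, - 1 / 2, 1 / 4:] * (defect2 + profile1 * defect1 + profile2 * defect0))"
  by (simp_all add: profile1_def profile2_def profile3_def defect0_def defect1_def defect2_def)

text \<open>The constants are the coefficients of the expansion of \<open>n * b\<close>. With
  \<open>r = (1 + q) / 2\<close> the polynomial factors are \<open>r\<^sup>2\<close> and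
  \<open>2 * r ^ 3\<close>; the zeroth profile is 1.\<close>

lemma defect_eq:
  "defect0 = [:1 / 4:] - [:1 / 4, 1 / 2, 1 / 4:]"
  "defect1 = [:- 1 / 64:] - ([:1 / 4, 1 / 2, 1 / 4:] * profile1 + [:1 / 4, 3 / 4, 3 / 4, 1 / 4:] * pderiv profile1)"
  "defect2 = [:- 5 / 512:] - ([:1 / 4, 1 / 2, 1 / 4:] * profile2 + [:1 / 4, 3 / 4, 3 / 4, 1 / 4:] * pderiv profile2)"
  "defect3 = [:63 / 8192:] - ([:1 / 4, 1 / 2, 1 / 4:] * profile3 + [:1 / 4, 3 / 4, 3 / 4, 1 / 4:] * pderiv profile3)"
  by (simp_all add: profile1_def profile2_def profile3_def defect0_def defect1_def defect2_def defect3_def pderiv_pCons)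

text \<open>The number \<delta> measures the deviation of \<open>n * b\<close> from its expansion at
  order \<open>e\<^sup>2\<close>. By \<open>residual_factor_q\<close> the terms up to that order
  cancel, and what remains has the factor \<open>e ^ 3\<close>.\<close>

lemma second_order_residual:
  "barrier_residual e (1 / 4 - e / 64 + e\<^sup>2 * (\<delta> - 5 / 512)) (1 + smult e profile1 + smult (e\<^sup>2) profile2) q
    = ((1 - q) / 2)\<^sup>2 * e ^ 3 *
      (\<delta> * poly (1 + smult e profile1 + smult (e\<^sup>2) profile2) q
       + poly (defect2 + profile1 * defect1 + profile2 * defect0) q
       + e * (poly profile1 q * poly defect2 q + poly profile2 q * poly defect1 q)
       + e\<^sup>2 * (poly profile2 q * poly defect2 q))"
proof -
  note 1 = residual_factor_q[THEN arg_cong[where f = "\<lambda>p. poly p q"]]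
  note 2 = defect_eq[THEN arg_cong[where f = "\<lambda>p. poly p q"]]
  define u r where "u = (1 - q) / 2" and "r = (1 + q) / 2"
  have u: "poly [:1 / 4, - 1 / 2, 1 / 4:] q = u\<^sup>2" and r: "poly [:1 / 4, 1 / 2, 1 / 4:] q = r\<^sup>2"
    and r2: "poly [:1 / 4, 3 / 4, 3 / 4, 1 / 4:] q = 2 * r ^ 3"
    by (simp_all add: u_def r_def field_simps power2_eq_square power3_eq_cube)
  define T1 T2 D1 D2 C0 C1 C2 where "T1 = poly profile1 q" and "T2 = poly profile2 q"
    and "D1 = poly (pderiv profile1) q" and "D2 = poly (pderiv profile2) q"
    and "C0 = poly defect0 q" and "C1 = poly defect1 q" and "C2 = poly defect2 q"
  note defs = T1_def T2_def D1_def D2_def C0_def C1_def C2_def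
  have qT: "q * T1 = - (u\<^sup>2 * C0)" "q * T2 = - (u\<^sup>2 * (C1 + T1 * C0))"
    using 1 unfolding poly_mult poly_add poly_minus u by (simp_all add: defs)
  have C: "C0 = 1 / 4 - r\<^sup>2" "C1 = - 1 / 64 - (r\<^sup>2 * T1 + 2 * r ^ 3 * D1)"
    "C2 = - 5 / 512 - (r\<^sup>2 * T2 + 2 * r ^ 3 * D2)"
    using 2 unfolding poly_mult poly_add poly_diff r r2 by (simp_all add: defs)
  let ?T = "1 + e * T1 + e\<^sup>2 * T2"
  \<comment> \<open>The last factor of the residual becomes the sum of the defects, with \<delta>
    added to the highest one.\<close>
  have "1 / 4 - e / 64 + e\<^sup>2 * (\<delta> - 5 / 512) - r\<^sup>2 * ?T - 2 * r ^ 3 * (e * D1 + e\<^sup>2 * D2)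
      = C0 + e * C1 + e\<^sup>2 * (C2 + \<delta>)"
    unfolding C by algebra
  moreover have "q * (?T - 1) = - u\<^sup>2 * (e * C0 + e\<^sup>2 * (C1 + T1 * C0))"
    using qT by algebra
  moreover have "- u\<^sup>2 * (e * C0 + e\<^sup>2 * (C1 + T1 * C0)) + e * u\<^sup>2 * ?T * (C0 + e * C1 + e\<^sup>2 * (C2 + \<delta>))
    = u\<^sup>2 * e ^ 3 * (\<delta> * ?T + (C2 + T1 * C1 + T2 * C0) + e * (T1 * C2 + T2 * C1) + e\<^sup>2 * (T2 * C2))"
    by algebra
  ultimately have "q * (?T - 1) + e * u\<^sup>2 * ?T *
      (1 / 4 - e / 64 + e\<^sup>2 * (\<delta> - 5 / 512) - r\<^sup>2 * ?T - 2 * r ^ 3 * (e * D1 + e\<^sup>2 * D2))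
    = u\<^sup>2 * e ^ 3 * (\<delta> * ?T + (C2 + T1 * C1 + T2 * C0) + e * (T1 * C2 + T2 * C1) + e\<^sup>2 * (T2 * C2))"
    by (simp only:)
  thus ?thesis
    by (simp add: barrier_residual_def pderiv_add pderiv_smult u_def r_def defs del: power_divide)
qed

text \<open>The same cancellation one order further, with \<delta> the deviation at order
  \<open>e ^ 3\<close>.\<close>

lemma third_order_residual:
  "barrier_residual e (1 / 4 - e / 64 - 5 * e\<^sup>2 / 512 + e ^ 3 * (\<delta> + 63 / 8192))
      (1 + smult e profile1 + smult (e\<^sup>2) profile2 + smult (e ^ 3) profile3) q
    = ((1 - q) / 2)\<^sup>2 * e ^ 4 *
      (\<delta> * poly (1 + smult e profile1 + smult (e\<^sup>2) profile2 + smult (e ^ 3) profile3) q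
       + poly (defect3 + profile1 * defect2 + profile2 * defect1 + profile3 * defect0) q
       + e * (poly profile1 q * poly defect3 q + poly profile2 q * poly defect2 q + poly profile3 q * poly defect1 q)
       + e\<^sup>2 * (poly profile2 q * poly defect3 q + poly profile3 q * poly defect2 q)
       + e ^ 3 * (poly profile3 q * poly defect3 q))"
proof -
  note 1 = residual_factor_q[THEN arg_cong[where f = "\<lambda>p. poly p q"]]
  note 2 = defect_eq[THEN arg_cong[where f = "\<lambda>p. poly p q"]]
  define u r where "u = (1 - q) / 2" and "r = (1 + q) / 2"
  have u: "poly [:1 / 4, - 1 / 2, 1 / 4:] q = u\<^sup>2" and r: "poly [:1 / 4, 1 / 2, 1 / 4:] q = r\<^sup>2"
    and r2: "poly [:1 / 4, 3 / 4, 3 / 4, 1 / 4:] q = 2 * r ^ 3"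
    by (simp_all add: u_def r_def field_simps power2_eq_square power3_eq_cube)
  define T1 T2 T3 D1 D2 D3 C0 C1 C2 C3 where "T1 = poly profile1 q" and "T2 = poly profile2 q"
    and "T3 = poly profile3 q" and "D1 = poly (pderiv profile1) q" and "D2 = poly (pderiv profile2) q"
    and "D3 = poly (pderiv profile3) q"
    and "C0 = poly defect0 q" and "C1 = poly defect1 q" and "C2 = poly defect2 q" and "C3 = poly defect3 q"
  note defs = T1_def T2_def T3_def D1_def D2_def D3_def C0_def C1_def C2_def C3_def
  have qT: "q * T1 = - (u\<^sup>2 * C0)" "q * T2 = - (u\<^sup>2 * (C1 + T1 * C0))"
    "q * T3 = - (u\<^sup>2 * (C2 + T1 * C1 + T2 * C0))"
    using 1 unfolding poly_mult poly_add poly_minus u by (simp_all add: defs)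
  have C: "C0 = 1 / 4 - r\<^sup>2" "C1 = - 1 / 64 - (r\<^sup>2 * T1 + 2 * r ^ 3 * D1)"
    "C2 = - 5 / 512 - (r\<^sup>2 * T2 + 2 * r ^ 3 * D2)" "C3 = 63 / 8192 - (r\<^sup>2 * T3 + 2 * r ^ 3 * D3)"
    using 2 unfolding poly_mult poly_add poly_diff r r2 by (simp_all add: defs)
  let ?T = "1 + e * T1 + e\<^sup>2 * T2 + e ^ 3 * T3"
  have "1 / 4 - e / 64 - 5 * e\<^sup>2 / 512 + e ^ 3 * (\<delta> + 63 / 8192) - r\<^sup>2 * ?T
        - 2 * r ^ 3 * (e * D1 + e\<^sup>2 * D2 + e ^ 3 * D3)
      = C0 + e * C1 + e\<^sup>2 * C2 + e ^ 3 * (C3 + \<delta>)"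
    unfolding C by algebra
  moreover have "q * (?T - 1) = - u\<^sup>2 * (e * C0 + e\<^sup>2 * (C1 + T1 * C0) + e ^ 3 * (C2 + T1 * C1 + T2 * C0))"
    using qT by algebra
  moreover have "- u\<^sup>2 * (e * C0 + e\<^sup>2 * (C1 + T1 * C0) + e ^ 3 * (C2 + T1 * C1 + T2 * C0))
      + e * u\<^sup>2 * ?T * (C0 + e * C1 + e\<^sup>2 * C2 + e ^ 3 * (C3 + \<delta>))
    = u\<^sup>2 * e ^ 4 * (\<delta> * ?T + (C3 + T1 * C2 + T2 * C1 + T3 * C0)
      + e * (T1 * C3 + T2 * C2 + T3 * C1) + e\<^sup>2 * (T2 * C3 + T3 * C2) + e ^ 3 * (T3 * C3))"
    by algebra
  ultimately have "q * (?T - 1) + e * u\<^sup>2 * ?T *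
      (1 / 4 - e / 64 - 5 * e\<^sup>2 / 512 + e ^ 3 * (\<delta> + 63 / 8192) - r\<^sup>2 * ?T
        - 2 * r ^ 3 * (e * D1 + e\<^sup>2 * D2 + e ^ 3 * D3))
    = u\<^sup>2 * e ^ 4 * (\<delta> * ?T + (C3 + T1 * C2 + T2 * C1 + T3 * C0)
      + e * (T1 * C3 + T2 * C2 + T3 * C1) + e\<^sup>2 * (T2 * C3 + T3 * C2) + e ^ 3 * (T3 * C3))"
    by (simp only:)
  thus ?thesis
    by (simp add: barrier_residual_def pderiv_add pderiv_smult u_def r_def defs del: power_divide)
qed

section \<open>Signs of the residuals\<close>

text \<open>The term with \<delta> dominates: its absolute value is at least 0.49 times 0.9, that is
  0.441, while the other terms in the bracket sum to at most 0.4.\<close>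

lemma second_order_residual_sign:
  assumes e: "0 < e" "e \<le> 1 / 25" and \<delta>: "49 / 100 \<le> \<bar>\<delta>\<bar>" and q: "- 1 < q" "q < 1"
  shows "0 < \<delta> * barrier_residual e (1 / 4 - e / 64 + e\<^sup>2 * (\<delta> - 5 / 512))
    (1 + smult e profile1 + smult (e\<^sup>2) profile2) q"
proof -
  have q_le: "\<bar>q\<bar> \<le> 1" using q by linarith
  note b = profile_bounds[OF q_le]
  let ?T = "poly (1 + smult e profile1 + smult (e\<^sup>2) profile2) q"
  let ?P = "poly (defect2 + profile1 * defect1 + profile2 * defect0) q"
  let ?X = "poly profile1 q * poly defect2 q + poly profile2 q * poly defect1 q"
  let ?Y = "poly profile2 q * poly defect2 q"
  have e2: "e\<^sup>2 \<le> (1 / 25)\<^sup>2"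
    using e by (intro power_mono) auto
  have prod: "\<bar>a * b\<bar> \<le> A * B" if "\<bar>a\<bar> \<le> A" "\<bar>b\<bar> \<le> B" for a b A B :: real
    unfolding abs_mult using that by (intro mult_mono) auto
  have "\<bar>e * poly profile1 q\<bar> \<le> 1 / 25 * (3 / 8)" "\<bar>e\<^sup>2 * poly profile2 q\<bar> \<le> (1 / 25)\<^sup>2 * (3 / 10)"
    "\<bar>e * ?X\<bar> \<le> 1 / 25 * (3 / 8 * (5 / 6) + 3 / 10 * (3 / 5))"
    "\<bar>e\<^sup>2 * ?Y\<bar> \<le> (1 / 25)\<^sup>2 * (3 / 10 * (5 / 6))"
    by (intro prod order_trans[OF abs_triangle_ineq add_mono] b; use e e2 in simp)+
  moreover have "?T = 1 + e * poly profile1 q + e\<^sup>2 * poly profile2 q" by simp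
  moreover have "\<bar>?P\<bar> \<le> 1 / 5" by (rule second_order_defect_bound[OF q_le])
  ultimately have T: "?T \<ge> 9 / 10" and R: "\<bar>?P + e * ?X + e\<^sup>2 * ?Y\<bar> \<le> 2 / 5"
    unfolding abs_le_iff by (simp_all add: power2_eq_square)
  have "\<bar>\<delta>\<bar> * (49 / 100 * (9 / 10)) \<le> \<bar>\<delta>\<bar> * (\<bar>\<delta>\<bar> * ?T)"
    using \<delta> T by (intro mult_left_mono mult_mono) auto
  moreover have "\<bar>\<delta> * (?P + e * ?X + e\<^sup>2 * ?Y)\<bar> \<le> \<bar>\<delta>\<bar> * (2 / 5)"
    unfolding abs_mult using R by (intro mult_left_mono) auto
  ultimately have "0 < \<delta> * (\<delta> * ?T) + \<delta> * (?P + e * ?X + e\<^sup>2 * ?Y)"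
    using \<delta> by (simp add: abs_le_iff flip: abs_mult mult.assoc)
  hence "0 < ((1 - q) / 2)\<^sup>2 * e ^ 3 * (\<delta> * (\<delta> * ?T) + \<delta> * (?P + e * ?X + e\<^sup>2 * ?Y))"
    using e q by (intro mult_pos_pos) auto
  thus ?thesis
    unfolding second_order_residual by (simp only: algebra_simps)
qed

text \<open>Here 0.117 times 0.99 is about 0.1158, to be compared with 0.114 for the remaining
  terms.\<close>

lemma third_order_residual_sign:
  assumes e: "0 < e" "e \<le> 1 / 676" and \<delta>: "117 / 1000 \<le> \<bar>\<delta>\<bar>" and q: "- 1 < q" "q < 1"
  shows "0 < \<delta> * barrier_residual e (1 / 4 - e / 64 - 5 * e\<^sup>2 / 512 + e ^ 3 * (\<delta> + 63 / 8192))
    (1 + smult e profile1 + smult (e\<^sup>2) profile2 + smult (e ^ 3) profile3) q"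
proof -
  have q_le: "\<bar>q\<bar> \<le> 1" using q by linarith
  note b = profile_bounds[OF q_le]
  let ?T = "poly (1 + smult e profile1 + smult (e\<^sup>2) profile2 + smult (e ^ 3) profile3) q"
  let ?P = "poly (defect3 + profile1 * defect2 + profile2 * defect1 + profile3 * defect0) q"
  let ?X = "poly profile1 q * poly defect3 q + poly profile2 q * poly defect2 q + poly profile3 q * poly defect1 q"
  let ?Y = "poly profile2 q * poly defect3 q + poly profile3 q * poly defect2 q"
  let ?Z = "poly profile3 q * poly defect3 q"
  have e2: "e\<^sup>2 \<le> (1 / 676)\<^sup>2" and e3: "e ^ 3 \<le> (1 / 676) ^ 3"
    using e by (intro power_mono; simp)+
  have prod: "\<bar>a * b\<bar> \<le> A * B" if "\<bar>a\<bar> \<le> A" "\<bar>b\<bar> \<le> B" for a b A B :: real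
    unfolding abs_mult using that by (intro mult_mono) auto
  have "\<bar>e * poly profile1 q\<bar> \<le> 1 / 676 * (3 / 8)" "\<bar>e\<^sup>2 * poly profile2 q\<bar> \<le> (1 / 676)\<^sup>2 * (3 / 10)"
    "\<bar>e ^ 3 * poly profile3 q\<bar> \<le> (1 / 676) ^ 3 * (1 / 2)"
    "\<bar>e * ?X\<bar> \<le> 1 / 676 * (3 / 8 * 2 + 3 / 10 * (5 / 6) + 1 / 2 * (3 / 5))"
    "\<bar>e\<^sup>2 * ?Y\<bar> \<le> (1 / 676)\<^sup>2 * (3 / 10 * 2 + 1 / 2 * (5 / 6))"
    "\<bar>e ^ 3 * ?Z\<bar> \<le> (1 / 676) ^ 3 * (1 / 2 * 2)"
    by (intro prod order_trans[OF abs_triangle_ineq add_mono] b; use e e2 e3 in simp)+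
  moreover have "?T = 1 + e * poly profile1 q + e\<^sup>2 * poly profile2 q + e ^ 3 * poly profile3 q" by simp
  moreover have "\<bar>?P\<bar> \<le> 11 / 100" by (rule third_order_defect_bound[OF q_le])
  ultimately have T: "?T \<ge> 99 / 100" and R: "\<bar>?P + e * ?X + e\<^sup>2 * ?Y + e ^ 3 * ?Z\<bar> \<le> 114 / 1000"
    unfolding abs_le_iff by (simp_all add: power2_eq_square power3_eq_cube)
  have "\<bar>\<delta>\<bar> * (117 / 1000 * (99 / 100)) \<le> \<bar>\<delta>\<bar> * (\<bar>\<delta>\<bar> * ?T)"
    using \<delta> T by (intro mult_left_mono mult_mono) auto
  moreover have "\<bar>\<delta> * (?P + e * ?X + e\<^sup>2 * ?Y + e ^ 3 * ?Z)\<bar> \<le> \<bar>\<delta>\<bar> * (114 / 1000)"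
    unfolding abs_mult using R by (intro mult_left_mono) auto
  ultimately have "0 < \<delta> * (\<delta> * ?T) + \<delta> * (?P + e * ?X + e\<^sup>2 * ?Y + e ^ 3 * ?Z)"
    using \<delta> by (simp add: abs_le_iff flip: abs_mult mult.assoc)
  hence "0 < ((1 - q) / 2)\<^sup>2 * e ^ 4 * (\<delta> * (\<delta> * ?T) + \<delta> * (?P + e * ?X + e\<^sup>2 * ?Y + e ^ 3 * ?Z))"
    using e q by (intro mult_pos_pos) auto
  thus ?thesis
    unfolding third_order_residual by (simp only: algebra_simps)
qed

section \<open>Bounds for the bifurcation value\<close>

lemma heteroclinic_second_order:
  assumes n: "n > 5" and conn: "heteroclinic_at_infinity n b"
  shows "\<bar>1 / (4 * n) - 1 / (64 * n ^ 3) - b\<bar> < 1 / (2 * n ^ 5)"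
proof (rule ccontr)
  assume "\<not> ?thesis"
  hence far: "1 / (2 * n ^ 5) \<le> \<bar>1 / (4 * n) - 1 / (64 * n ^ 3) - b\<bar>" by simp
  define e where "e = 1 / n\<^sup>2"
  define \<delta> where "\<delta> = (n * b - 1 / 4 + e / 64) / e\<^sup>2 + 5 / 512"
  have "5\<^sup>2 \<le> n\<^sup>2" using n by (intro power_mono) auto
  hence e: "0 < e" "e \<le> 1 / 25" using n by (simp_all add: e_def divide_simps)
  have b: "n * b = 1 / 4 - e / 64 + e\<^sup>2 * (\<delta> - 5 / 512)"
    using e by (simp add: \<delta>_def)
  \<comment> \<open>The power \<open>n ^ 5\<close> combines the factor \<open>n\<close> of
    \<open>n * b\<close> with \<open>n ^ 4 = 1 / e\<^sup>2\<close>.\<close>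
  have "\<delta> - 5 / 512 = - (n ^ 5 * (1 / (4 * n) - 1 / (64 * n ^ 3) - b))"
    using n by (simp add: \<delta>_def e_def field_simps eval_nat_numeral)
  hence "\<bar>\<delta> - 5 / 512\<bar> = n ^ 5 * \<bar>1 / (4 * n) - 1 / (64 * n ^ 3) - b\<bar>"
    using n by (simp only: abs_minus_cancel abs_mult) simp
  also have "\<dots> \<ge> n ^ 5 * (1 / (2 * n ^ 5))"
    using n by (intro mult_left_mono far) auto
  finally have "1 / 2 \<le> \<bar>\<delta> - 5 / 512\<bar>"
    using n by simp
  \<comment> \<open>Shifting by the next coefficient of the expansion costs little:
    \<open>1 / 2 - 5 / 512\<close> is about 0.4902.\<close>
  hence \<delta>: "49 / 100 \<le> \<bar>\<delta>\<bar>"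
    by linarith
  show False
    using barrier_excludes_connection[OF _ conn, of \<delta> "1 + smult e profile1 + smult (e\<^sup>2) profile2"]
      second_order_residual_sign[OF e \<delta>] n b by (simp add: e_def)
qed

lemma heteroclinic_third_order:
  assumes n: "n > 26" and conn: "heteroclinic_at_infinity n b"
  shows "\<bar>1 / (4 * n) - 1 / (64 * n ^ 3) - 5 / (512 * n ^ 5) - b\<bar> < 1 / (8 * n ^ 7)"
proof (rule ccontr)
  assume "\<not> ?thesis"
  hence far: "1 / (8 * n ^ 7) \<le> \<bar>1 / (4 * n) - 1 / (64 * n ^ 3) - 5 / (512 * n ^ 5) - b\<bar>" by simp
  define e where "e = 1 / n\<^sup>2"
  define \<delta> where "\<delta> = (n * b - 1 / 4 + e / 64 + 5 * e\<^sup>2 / 512) / e ^ 3 - 63 / 8192"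
  have "26\<^sup>2 \<le> n\<^sup>2" using n by (intro power_mono) auto
  hence e: "0 < e" "e \<le> 1 / 676" using n by (simp_all add: e_def divide_simps)
  have b: "n * b = 1 / 4 - e / 64 - 5 * e\<^sup>2 / 512 + e ^ 3 * (\<delta> + 63 / 8192)"
    using e by (simp add: \<delta>_def)
  have "\<delta> + 63 / 8192 = - (n ^ 7 * (1 / (4 * n) - 1 / (64 * n ^ 3) - 5 / (512 * n ^ 5) - b))"
    using n by (simp add: \<delta>_def e_def field_simps eval_nat_numeral)
  hence "\<bar>\<delta> + 63 / 8192\<bar> = n ^ 7 * \<bar>1 / (4 * n) - 1 / (64 * n ^ 3) - 5 / (512 * n ^ 5) - b\<bar>"
    using n by (simp only: abs_minus_cancel abs_mult) simp
  also have "\<dots> \<ge> n ^ 7 * (1 / (8 * n ^ 7))"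
    using n by (intro mult_left_mono far) auto
  finally have "1 / 8 \<le> \<bar>\<delta> + 63 / 8192\<bar>"
    using n by simp
  \<comment> \<open>Here \<open>1 / 8 - 63 / 8192\<close> is about 0.1173.\<close>
  hence \<delta>: "117 / 1000 \<le> \<bar>\<delta>\<bar>"
    by linarith
  show False
    using barrier_excludes_connection[OF _ conn, of \<delta>
        "1 + smult e profile1 + smult (e\<^sup>2) profile2 + smult (e ^ 3) profile3"]
      third_order_residual_sign[OF e \<delta>] n b by (simp add: e_def)
qed

theorem theorem1p1:
  fixes bstar :: "real \<Rightarrow> real"
  assumes "\<And>n. n > 0 \<Longrightarrow> limit_cycle_threshold n (bstar n)"
    and "\<And>n. n > 0 \<Longrightarrow> heteroclinic_at_infinity n (bstar n)"
  shows "(\<forall>n>14. \<bar>1 / (4 * n) - bstar n\<bar> < 1 / (8 * n ^ 3)) \<and>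
         (\<forall>n>5. \<bar>1 / (4 * n) - 1 / (64 * n ^ 3) - bstar n\<bar> < 1 / (2 * n ^ 5)) \<and>
         (\<forall>n>26. \<bar>1 / (4 * n) - 1 / (64 * n ^ 3) - 5 / (512 * n ^ 5) - bstar n\<bar> < 1 / (8 * n ^ 7))"
proof (intro conjI allI impI)
  show second: "\<bar>1 / (4 * n) - 1 / (64 * n ^ 3) - bstar n\<bar> < 1 / (2 * n ^ 5)" if "n > 5" for n
    using that assms(2) by (intro heteroclinic_second_order) auto
  show "\<bar>1 / (4 * n) - 1 / (64 * n ^ 3) - 5 / (512 * n ^ 5) - bstar n\<bar> < 1 / (8 * n ^ 7)" if "n > 26" for n
    using that assms(2) by (intro heteroclinic_third_order) auto
  show "\<bar>1 / (4 * n) - bstar n\<bar> < 1 / (8 * n ^ 3)" if "n > 14" for n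
  proof -
    have "14\<^sup>2 \<le> n\<^sup>2" using that by (intro power_mono) auto
    \<comment> \<open>After clearing denominators, absorbing the term
      \<open>1 / (64 * n ^ 3)\<close> into the coarser bound amounts to
      \<open>32 \<le> 7 * n\<^sup>2\<close>.\<close>
    hence "32 * 1 / (64 * n ^ 5) \<le> 7 * n\<^sup>2 / (64 * n ^ 5)"
      using that by (intro divide_right_mono) auto
    also have "\<dots> = 1 / (8 * n ^ 3) - 1 / (64 * n ^ 3)"
      using that by (simp add: field_simps eval_nat_numeral)
    finally have "1 / (2 * n ^ 5) + 1 / (64 * n ^ 3) \<le> 1 / (8 * n ^ 3)"
      by simp
    moreover have "1 / (64 * n ^ 3) > 0"
      using that by simp
    moreover have "\<bar>1 / (4 * n) - 1 / (64 * n ^ 3) - bstar n\<bar> < 1 / (2 * n ^ 5)"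
      using second that by simp
    ultimately show ?thesis by linarith
  qed
qed

end
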